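(* Let $I$ be a set and let $(X_i)_{i\in I}$ and $Y$ be random variables on a common probability space; let $\mathcal M$ be the natural $\sigma$-metalgebra of this system, i.e. the $\sigma$-metalgebra spanned by the $X_i$ ($i\in I$) and $Y$. Suppose that for all $i\in I$ one has $\{X_i:Y\}_{\mathcal M}\le\epsilon_i$, with $\epsilon_i\in[0,1]$. Then, writing $\vec X_I=(X_i)_{i\in I}$, $$\{\vec X_I:Y\}\ \le\ \sqrt{1-\prod_{i\in I}(1-\epsilon_i^2)}.$$
   Context: Random variables may take values in arbitrary measurable spaces. For random variables $X,Y$ the Hilbertian (maximal) correlation coefficient is $\{X:Y\}=\{\sigma(X):\sigma(Y)\}$ where, for $\sigma$-algebras $\mathcal F,\mathcal G$, $\{\mathcal F:\mathcal G\}$ is the supremum of $|\operatorname{Cov}(f,g)|/(\operatorname{sd}(f)\operatorname{sd}(g))$ over real square-integrable, not a.s. constant $f$ ($\mathcal F$-measurable) and $g$ ($\mathcal G$-measurable) ($0$ if one of the $\sigma$-algebras is trivial; $\operatorname{sd}$ is the standard deviation). Subjective correlation: for $\sigma$-algebras $\mathcal F,\mathcal G,\mathcal H$, $\{\mathcal F:\mathcal G\}_{\mathcal H}$ is the smallest $\epsilon\in[0,1]$ such that $|\mathbf E[fg]|\le\epsilon\operatorname{sd}(f)\operatorname{sd}(g)$ for all real square-integrable $f$ ($\mathcal F\vee\mathcal H$-measurable) and $g$ ($\mathcal G\vee\mathcal H$-measurable) with $\mathbf E[f|\mathcal H]=\mathbf E[g|\mathcal H]=0$ a.s. (for variables $X,Y,Z$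 this says $\{X:Y\}\le\epsilon$ under the conditional law given $Z=z$ for almost all $z$). The $\sigma$-metalgebra spanned by random variables $(Z_k)_{k\in K}$ is the set $\mathcal M$ of the $\sigma$-algebras $\sigma((Z_k)_{k\in K'})$, $K'\subset K$, and $\{X:Y\}_{\mathcal M}=\sup_{\mathcal H\in\mathcal M}\{\sigma(X):\sigma(Y)\}_{\mathcal H}$. *)

theory Defs
  imports "HOL-Probability.Probability"
begin

text \<open>
  A sub-sigma-algebra of a probability space \<open>M\<close> is represented by a measure object of which only
  \<open>space\<close> and \<open>sets\<close> matter, as in the library's \<open>subalgebra\<close> and \<open>real_cond_exp\<close>.  The
  sigma-algebra of a random variable \<open>X\<close> with values in \<open>N\<close> is \<open>vimage_algebra (space M) X N\<close>.
\<close>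

definition sd :: "'a measure \<Rightarrow> ('a \<Rightarrow> real) \<Rightarrow> real"
  where "sd M f = sqrt (prob_space.variance M f)"

definition Cov :: "'a measure \<Rightarrow> ('a \<Rightarrow> real) \<Rightarrow> ('a \<Rightarrow> real) \<Rightarrow> real"
  where "Cov M f g =
    prob_space.expectation M
      (\<lambda>x. (f x - prob_space.expectation M f) * (g x - prob_space.expectation M g))"

definition sq_integrable :: "'a measure \<Rightarrow> 'a measure \<Rightarrow> ('a \<Rightarrow> real) set"
  where "sq_integrable M F = {f \<in> borel_measurable F. integrable M (\<lambda>x. (f x)\<^sup>2)}"

definition ae_const :: "'a measure \<Rightarrow> ('a \<Rightarrow> real) \<Rightarrow> bool"
  where "ae_const M f \<longleftrightarrow> (\<exists>c. AE x in M. f x = c)"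

text \<open>
  All the quotients are nonnegative, so inserting \<open>0\<close> only has an effect when there is no admissible
  pair \<open>f\<close>, \<open>g\<close>, that is, when one of the sigma-algebras is trivial; the coefficient is then \<open>0\<close>.
\<close>

definition max_corr :: "'a measure \<Rightarrow> 'a measure \<Rightarrow> 'a measure \<Rightarrow> real"
  where "max_corr M F G =
    Sup (insert 0 {\<bar>Cov M f g\<bar> / (sd M f * sd M g) | f g.
      f \<in> sq_integrable M F \<and> \<not> ae_const M f \<and>
      g \<in> sq_integrable M G \<and> \<not> ae_const M g})"

definition sigma_join :: "'a measure \<Rightarrow> 'k set \<Rightarrow> ('k \<Rightarrow> 'a measure) \<Rightarrow> 'a measure"
  where "sigma_join M K F = sigma (space M) (\<Union>k\<in>K. sets (F k))"

abbreviation sigma_join2 :: "'a measure \<Rightarrow> 'a measure \<Rightarrow> 'a measure \<Rightarrow> 'a measure"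
  where "sigma_join2 M F G \<equiv> sigma (space M) (sets F \<union> sets G)"

text \<open>
  The minimum exists whenever \<open>F\<close>, \<open>G\<close>, \<open>H\<close> are sub-sigma-algebras of a probability space: \<open>\<epsilon> = 1\<close> is
  admissible by Cauchy-Schwarz, and the conditions on \<open>\<epsilon>\<close> are closed.
\<close>

definition subj_corr :: "'a measure \<Rightarrow> 'a measure \<Rightarrow> 'a measure \<Rightarrow> 'a measure \<Rightarrow> real"
  where "subj_corr M H F G =
    (LEAST \<epsilon>. \<epsilon> \<in> {0..1} \<and>
      (\<forall>f \<in> sq_integrable M (sigma_join2 M F H). \<forall>g \<in> sq_integrable M (sigma_join2 M G H).
        (AE x in M. real_cond_exp M H f x = 0) \<longrightarrow>
        (AE x in M. real_cond_exp M H g x = 0) \<longrightarrow>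
        \<bar>prob_space.expectation M (\<lambda>x. f x * g x)\<bar> \<le> \<epsilon> * sd M f * sd M g))"

text \<open>
  A family of random variables \<open>Z k\<close> (\<open>k \<in> K\<close>) enters the metalgebra only through the sigma-algebras
  \<open>F k\<close> they generate; this allows them to take values in spaces over different types.
\<close>

definition sigma_metalgebra :: "'a measure \<Rightarrow> 'k set \<Rightarrow> ('k \<Rightarrow> 'a measure) \<Rightarrow> 'a measure set"
  where "sigma_metalgebra M K F = {sigma_join M K' F | K'. K' \<subseteq> K}"

definition subj_corr_meta ::
    "'a measure \<Rightarrow> 'a measure set \<Rightarrow> 'a measure \<Rightarrow> 'a measure \<Rightarrow> real"
  where "subj_corr_meta M \<M> F G = (SUP H\<in>\<M>. subj_corr M H F G)"

text \<open>The index \<open>None\<close> stands for \<open>Y\<close>, the index \<open>Some i\<close> for \<open>X i\<close>.\<close>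

definition natural_metalgebra ::
    "'a measure \<Rightarrow> 'i set \<Rightarrow> ('i \<Rightarrow> 'b measure) \<Rightarrow> ('i \<Rightarrow> 'a \<Rightarrow> 'b) \<Rightarrow>
      'c measure \<Rightarrow> ('a \<Rightarrow> 'c) \<Rightarrow> 'a measure set"
  where "natural_metalgebra M I N X L Y =
    sigma_metalgebra M (insert None (Some ` I))
      (case_option (vimage_algebra (space M) Y L) (\<lambda>i. vimage_algebra (space M) (X i) (N i)))"

text \<open>
  Product over a possibly infinite index set, as the limit of the finite subproducts (for an infinite
  set, \<open>prod\<close> is \<open>1\<close> by convention).  For factors in \<open>[0,1]\<close> the limit always exists.
\<close>

definition net_prod :: "('i \<Rightarrow> real) \<Rightarrow> 'i set \<Rightarrow> real"
  where "net_prod p I = Lim (finite_subsets_at_top I) (prod p)"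

lemma net_prod_finite:
  assumes "finite I"
  shows "net_prod p I = prod p I"
proof -
  have "finite_subsets_at_top I = principal {I}"
    using assms by (rule finite_subsets_at_top_finite)
  then have "(prod p \<longlongrightarrow> prod p I) (finite_subsets_at_top I)"
    by (simp add: tendsto_principal_singleton)
  then show ?thesis
    unfolding net_prod_def by (intro tendsto_Lim) simp_all
qed

lemma prod_tendsto_net_prod:
  assumes p: "\<And>i. i \<in> I \<Longrightarrow> p i \<in> {0..1}"
  shows "(prod p \<longlongrightarrow> net_prod p I) (finite_subsets_at_top I)"
    and "net_prod p I = (INF J\<in>{J. finite J \<and> J \<subseteq> I}. prod p J)"
proof -
  let ?A = "{J. finite J \<and> J \<subseteq> I}"
  let ?l = "INF J\<in>?A. prod p J"
  have bdd: "bdd_below (prod p ` ?A)"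
    using p by (intro bdd_belowI[of _ 0]) (fastforce intro!: prod_nonneg)
  have ne: "prod p ` ?A \<noteq> {}" by blast
  have lim: "(prod p \<longlongrightarrow> ?l) (finite_subsets_at_top I)"
  proof (rule order_tendstoI)
    fix a assume a: "a < ?l"
    have "a < prod p J" if "finite J" "J \<subseteq> I" for J
    proof -
      have "?l \<le> prod p J" using that by (intro cInf_lower bdd) blast
      with a show ?thesis by simp
    qed
    then show "\<forall>\<^sub>F J in finite_subsets_at_top I. a < prod p J"
      by (intro eventually_finite_subsets_at_top_weakI)
  next
    fix a assume "?l < a"
    then obtain J where J: "finite J" "J \<subseteq> I" "prod p J < a"
      using cInf_lessD[OF ne] by blast
    have "prod p K < a" if "finite K" "J \<subseteq> K" "K \<subseteq> I" for K
    proof -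
      have "prod p K \<le> prod p J"
      proof -
        have "prod p K = prod p (K - J) * prod p J"
          using that by (intro prod.subset_diff)
        moreover have "prod p (K - J) \<le> 1" "0 \<le> prod p J"
          using that p by (fastforce intro!: prod_le_1 prod_nonneg)+
        ultimately show ?thesis by (simp add: mult_left_le mult.commute)
      qed
      with J show ?thesis by simp
    qed
    with J show "\<forall>\<^sub>F K in finite_subsets_at_top I. prod p K < a"
      unfolding eventually_finite_subsets_at_top by blast
  qed
  have eq: "net_prod p I = ?l"
    unfolding net_prod_def using lim by (intro tendsto_Lim) simp_all
  show "net_prod p I = ?l" by (rule eq)
  show "(prod p \<longlongrightarrow> net_prod p I) (finite_subsets_at_top I)"
    unfolding eq by (rule lim)
qed

end

theory Submission
  imports Defs
begin

text \<open>
  For a centred \<open>g\<close> in \<open>L\<^sup>2(\<sigma>(Y))\<close> and finite \<open>J \<subseteq> I\<close> consider the residual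
  \<open>V J = E[(g - E[g|X\<^sub>J])\<^sup>2]\<close>.  The function \<open>h = g - E[g|X\<^sub>J]\<close> is measurable with respect to \<open>Y\<close> and \<open>X\<^sub>J\<close>
  and has \<open>E[h|X\<^sub>J] = 0\<close>, so testing it against \<open>f = E[h|X\<^sub>J, X\<^sub>i]\<close> in the definition of the subjective
  correlation given \<open>X\<^sub>J\<close> yields \<open>E f\<^sup>2 \<le> \<epsilon>\<^sub>i\<^sup>2 E h\<^sup>2\<close>, that is, \<open>V (J \<union> {i}) \<ge> (1 - \<epsilon>\<^sub>i\<^sup>2) V J\<close>.  Multiplying these
  inequalities bounds \<open>V J\<close> from below, hence \<open>E[g|X\<^sub>J]\<close> from above in \<open>L\<^sup>2\<close>, and Cauchy-Schwarz bounds the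
  correlation of \<open>g\<close> with every function of \<open>X\<^sub>J\<close>.  For infinite \<open>I\<close>, the functions of finitely many
  \<open>X\<^sub>i\<close> are dense in \<open>L\<^sup>2(\<sigma>(X\<^sub>I))\<close>.
\<close>

subsection \<open>Joins of sub-sigma-algebras\<close>

lemma sq_integrable_mono:
  assumes "subalgebra K F"
  shows "sq_integrable M F \<subseteq> sq_integrable M K"
  using measurable_from_subalg[OF assms] by (auto simp: sq_integrable_def)

lemma subalgebra_refl: "subalgebra M M"
  by (simp add: subalgebra_def)

lemma sigma_join2_space [simp]: "space (sigma_join2 M F G) = space M"
  by (simp add: space_measure_of_conv)

lemma sigma_join_space [simp]: "space (sigma_join M K F) = space M"
  by (simp add: sigma_join_def space_measure_of_conv)

lemma sets_sigma_join:
  assumes "\<forall>k\<in>K. subalgebra M (F k)"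
  shows "sets (sigma_join M K F) = sigma_sets (space M) (\<Union>k\<in>K. sets (F k))"
  unfolding sigma_join_def using assms sets.sets_into_space
  by (intro sets_measure_of) (fastforce simp: subalgebra_def)

lemma subalgebra_sigma_join:
  assumes "\<forall>k\<in>K. subalgebra M (F k)"
  shows "subalgebra M (sigma_join M K F)"
  unfolding subalgebra_def sets_sigma_join[OF assms]
  using assms by (auto intro!: sets.sigma_sets_subset simp: subalgebra_def)

lemma subalgebra_sigma_join_mono:
  assumes "\<forall>k\<in>K. subalgebra M (F k)" "J \<subseteq> K"
  shows "subalgebra (sigma_join M K F) (sigma_join M J F)"
proof -
  have J: "\<forall>k\<in>J. subalgebra M (F k)" using assms by blast
  have "(\<Union>k\<in>J. sets (F k)) \<subseteq> (\<Union>k\<in>K. sets (F k))" using assms by blast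
  then show ?thesis
    unfolding subalgebra_def sets_sigma_join[OF J] sets_sigma_join[OF assms(1)]
    by (simp add: sigma_sets_mono')
qed

lemma sets_sigma_join2:
  assumes "subalgebra M F" "subalgebra M G"
  shows "sets (sigma_join2 M F G) = sigma_sets (space M) (sets F \<union> sets G)"
  using assms sets.sets_into_space
  by (intro sets_measure_of) (fastforce simp: subalgebra_def)

lemma subalgebra_sigma_join2:
  assumes "subalgebra M F" "subalgebra M G"
  shows "subalgebra M (sigma_join2 M F G)"
  unfolding subalgebra_def sets_sigma_join2[OF assms]
  using assms by (auto intro!: sets.sigma_sets_subset simp: subalgebra_def)

lemma
  assumes "subalgebra M F" "subalgebra M G"
  shows subalgebra_sigma_join2_left: "subalgebra (sigma_join2 M F G) F"
    and subalgebra_sigma_join2_right: "subalgebra (sigma_join2 M F G) G"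
  using assms unfolding subalgebra_def[of "sigma_join2 M F G"] sets_sigma_join2[OF assms]
  by (auto simp: subalgebra_def)

text \<open>Enlarging the index set by one element is a binary join with the old sigma-algebra. This
  has the shape \<open>F\<close> joined with \<open>H\<close> that occurs in
  \<open>subj_corr\<close>, so an induction over index sets can use the subjective correlation in
  each step.\<close>

lemma sigma_join_insert:
  assumes k: "subalgebra M (F k)" and K: "\<forall>k\<in>K. subalgebra M (F k)"
  shows "sigma_join M (insert k K) F = sigma_join2 M (F k) (sigma_join M K F)"
proof (rule measure_eqI)
  have ins: "\<forall>j\<in>insert k K. subalgebra M (F j)" using assms by blast
  let ?U = "\<Union>k\<in>K. sets (F k)"
  have "sigma_sets (space M) (sets (F k) \<union> ?U)
      = sigma_sets (space M) (sets (F k) \<union> sigma_sets (space M) ?U)"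
  proof (rule sigma_sets_eqI)
    show "A \<in> sigma_sets (space M) (sets (F k) \<union> ?U)"
      if "A \<in> sets (F k) \<union> sigma_sets (space M) ?U" for A
      using that sigma_sets_mono'[of ?U "sets (F k) \<union> ?U" "space M"] by auto
  qed auto
  then show "sets (sigma_join M (insert k K) F) = sets (sigma_join2 M (F k) (sigma_join M K F))"
    unfolding sets_sigma_join[OF ins] sets_sigma_join2[OF k subalgebra_sigma_join[OF K]]
    unfolding sets_sigma_join[OF K]
    by (simp add: UN_insert)
qed (simp add: sigma_join_def emeasure_sigma)

subsection \<open>Square-integrable functions\<close>

context prob_space
begin

lemma sq_integrable_mult_integrable:
  assumes "f \<in> sq_integrable M M" "g \<in> sq_integrable M M"
  shows "integrable M (\<lambda>x. f x * g x)"
proof (rule Bochner_Integration.integrable_bound)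
  show "integrable M (\<lambda>x. (f x)\<^sup>2 + (g x)\<^sup>2)"
    using assms by (auto simp: sq_integrable_def)
  show "(\<lambda>x. f x * g x) \<in> borel_measurable M"
    using assms by (auto simp: sq_integrable_def)
  have "\<bar>a * b\<bar> \<le> a\<^sup>2 + b\<^sup>2" for a b :: real
  proof -
    have "0 \<le> \<bar>a\<bar> * \<bar>b\<bar>" by simp
    moreover have "2 * (\<bar>a\<bar> * \<bar>b\<bar>) \<le> a\<^sup>2 + b\<^sup>2"
      using sum_squares_bound[of "\<bar>a\<bar>" "\<bar>b\<bar>"] by (simp add: mult.assoc)
    ultimately show ?thesis unfolding abs_mult by linarith
  qed
  then show "AE x in M. norm (f x * g x) \<le> norm ((f x)\<^sup>2 + (g x)\<^sup>2)"
    by simp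
qed

lemma sq_integrable_integrable:
  "f \<in> sq_integrable M M \<Longrightarrow> integrable M f"
  by (auto simp: sq_integrable_def intro: square_integrable_imp_integrable)

lemma sq_integrable_scale:
  assumes "f \<in> sq_integrable M F"
  shows "(\<lambda>x. c * f x) \<in> sq_integrable M F"
  using assms by (auto simp: sq_integrable_def power_mult_distrib)

lemma sq_integrable_const: "(\<lambda>x. c) \<in> sq_integrable M F"
  by (auto simp: sq_integrable_def)

lemma sq_integrable_add:
  assumes "subalgebra M F" "f \<in> sq_integrable M F" "g \<in> sq_integrable M F"
  shows "(\<lambda>x. f x + g x) \<in> sq_integrable M F"
proof -
  have "f \<in> sq_integrable M M" "g \<in> sq_integrable M M"
    using sq_integrable_mono[OF assms(1)] assms by auto
  from sq_integrable_mult_integrable[OF this] show ?thesis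
    using assms by (auto simp: sq_integrable_def power2_sum mult.assoc)
qed

lemma sq_integrable_diff:
  assumes "subalgebra M F" "f \<in> sq_integrable M F" "g \<in> sq_integrable M F"
  shows "(\<lambda>x. f x - g x) \<in> sq_integrable M F"
  using sq_integrable_add[OF assms(1,2) sq_integrable_scale[OF assms(3), of "-1"]] by simp

lemma expectation_square_diff:
  assumes "f \<in> sq_integrable M M" "g \<in> sq_integrable M M"
  shows "expectation (\<lambda>x. (f x - g x)\<^sup>2)
    = expectation (\<lambda>x. (f x)\<^sup>2) - 2 * expectation (\<lambda>x. f x * g x) + expectation (\<lambda>x. (g x)\<^sup>2)"
  using assms sq_integrable_mult_integrable[OF assms]
  by (simp add: power2_diff sq_integrable_def mult.assoc)

text \<open>The quadratic form \<open>E[(s f - t g)^2]\<close> in \<open>(s, t)\<close> is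
  nonnegative, which bounds its mixed coefficient.\<close>

lemma Cauchy_Schwarz_expectation:
  assumes f: "f \<in> sq_integrable M M" and g: "g \<in> sq_integrable M M"
  shows "\<bar>expectation (\<lambda>x. f x * g x)\<bar>
    \<le> sqrt (expectation (\<lambda>x. (f x)\<^sup>2)) * sqrt (expectation (\<lambda>x. (g x)\<^sup>2))"
proof -
  define A where "A = expectation (\<lambda>x. (f x)\<^sup>2)"
  define B where "B = expectation (\<lambda>x. f x * g x)"
  define C where "C = expectation (\<lambda>x. (g x)\<^sup>2)"
  have quad: "0 \<le> s\<^sup>2 * A - 2 * (s * t * B) + t\<^sup>2 * C" for s t
  proof -
    have "0 \<le> expectation (\<lambda>x. (s * f x - t * g x)\<^sup>2)" by simp
    also have "\<dots> = s\<^sup>2 * A - 2 * (s * t * B) + t\<^sup>2 * C"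
      using expectation_square_diff[OF sq_integrable_scale[OF f, of s] sq_integrable_scale[OF g, of t]]
      by (simp add: A_def B_def C_def power_mult_distrib mult_ac
          flip: Bochner_Integration.integral_mult_right_zero)
    finally show ?thesis .
  qed
  have "0 \<le> A" by (simp add: A_def)
  have "B\<^sup>2 \<le> A * C"
  proof (cases "A = 0")
    case True
    \<comment> \<open>With \<open>A = 0\<close> and \<open>t = 1\<close> the form is affine in
      \<open>s\<close>; if \<open>B\<close> were nonzero, the chosen \<open>s\<close> would give it
      the value -1.\<close>
    have "B = 0"
      using quad[of "(C + 1) / (2 * B)" 1] True by (cases "B = 0") auto
    with True show ?thesis by simp
  next
    case False
    \<comment> \<open>At \<open>s = B\<close>, \<open>t = A\<close> the form equals \<open>A\<close>
      times the discriminant expression.\<close>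
    have "0 \<le> A * (A * C - B\<^sup>2)"
      using quad[of B A] by (simp add: power2_eq_square algebra_simps)
    with False \<open>0 \<le> A\<close> show ?thesis by (simp add: zero_le_mult_iff)
  qed
  then have "\<bar>B\<bar> \<le> sqrt (A * C)" using real_le_rsqrt by simp
  then show ?thesis by (simp add: A_def B_def C_def real_sqrt_mult)
qed

lemma sd_centered: "expectation f = 0 \<Longrightarrow> sd M f = sqrt (expectation (\<lambda>x. (f x)\<^sup>2))"
  by (simp add: sd_def)

section \<open>Conditional expectation as orthogonal projection in L2\<close>

lemma sigma_finite_subalgebraI: "subalgebra M F \<Longrightarrow> sigma_finite_subalgebra M F"
  by (intro finite_measure_subalgebra_is_sigma_finite finite_measure_subalgebra.intro
      finite_measure_subalgebra_axioms.intro finite_measure_axioms)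

text \<open>Jensen's inequality for the convex function \<open>x^2\<close>.\<close>

lemma sq_integrable_cond_exp:
  assumes "subalgebra M F" "f \<in> sq_integrable M M"
  shows "real_cond_exp M F f \<in> sq_integrable M F"
proof -
  interpret F: sigma_finite_subalgebra M F using assms by (simp add: sigma_finite_subalgebraI)
  have "integrable M (\<lambda>x. (real_cond_exp M F f x)\<^sup>2)"
    using sq_integrable_integrable[OF assms(2)] assms(2)
    by (intro F.integrable_convex_cond_exp[where I = UNIV])
       (auto simp: sq_integrable_def convex_power2)
  then show ?thesis by (simp add: sq_integrable_def)
qed

text \<open>Orthogonality: \<open>f - E[f|F]\<close> is perpendicular to every square-integrable
  \<open>F\<close>-measurable \<open>u\<close>.\<close>

lemma expectation_cond_exp_mult:
  assumes "subalgebra M F" "f \<in> sq_integrable M M" "u \<in> sq_integrable M F"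
  shows "expectation (\<lambda>x. u x * real_cond_exp M F f x) = expectation (\<lambda>x. u x * f x)"
proof -
  interpret F: sigma_finite_subalgebra M F using assms by (simp add: sigma_finite_subalgebraI)
  have "u \<in> sq_integrable M M" using sq_integrable_mono[OF assms(1)] assms(3) by blast
  then show ?thesis
    using assms by (intro F.real_cond_exp_intg sq_integrable_mult_integrable)
      (auto simp: sq_integrable_def)
qed

text \<open>Testing orthogonality against the projection itself turns the mixed term of the expanded
  square into the squared norm of the projection.\<close>

lemma residual_pythagoras:
  assumes F: "subalgebra M F" and f: "f \<in> sq_integrable M M"
  shows "expectation (\<lambda>x. (f x - real_cond_exp M F f x)\<^sup>2)
    = expectation (\<lambda>x. (f x)\<^sup>2) - expectation (\<lambda>x. (real_cond_exp M F f x)\<^sup>2)"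
proof -
  have c: "real_cond_exp M F f \<in> sq_integrable M F"
    by (rule sq_integrable_cond_exp[OF F f])
  have c': "real_cond_exp M F f \<in> sq_integrable M M"
    using c sq_integrable_mono[OF F] by blast
  show ?thesis
    using expectation_square_diff[OF f c'] expectation_cond_exp_mult[OF F f c]
    by (simp add: mult.commute power2_eq_square)
qed

text \<open>By orthogonality the two sides differ by exactly \<open>E[(c - u)^2]\<close>, where
  \<open>c\<close> is the projection of \<open>f\<close>.\<close>

lemma residual_minimal:
  assumes F: "subalgebra M F" and f: "f \<in> sq_integrable M M" and u: "u \<in> sq_integrable M F"
  shows "expectation (\<lambda>x. (f x - real_cond_exp M F f x)\<^sup>2) \<le> expectation (\<lambda>x. (f x - u x)\<^sup>2)"
proof -
  define c where "c = real_cond_exp M F f"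
  have c: "c \<in> sq_integrable M F"
    unfolding c_def by (rule sq_integrable_cond_exp[OF F f])
  have c': "c \<in> sq_integrable M M" and u': "u \<in> sq_integrable M M"
    using c u sq_integrable_mono[OF F] by auto
  have "0 \<le> expectation (\<lambda>x. (c x - u x)\<^sup>2)" by simp
  then show ?thesis
    using expectation_square_diff[OF c' u'] expectation_square_diff[OF f u']
      expectation_cond_exp_mult[OF F f u] residual_pythagoras[OF F f]
    unfolding c_def[symmetric] by (simp add: mult.commute)
qed

subsection \<open>Residuals and the subjective correlation\<close>

text \<open>\<open>LEAST\<close> over the reals says something only if a minimum exists. The
  admissible constants form a closed set bounded below, and 1 lies in it by Cauchy-Schwarz, so its
  infimum is admissible.\<close>

lemma subj_corr_attained:
  assumes F: "subalgebra M F" and G: "subalgebra M G" and H: "subalgebra M H"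
  shows "subj_corr M H F G \<in> {0..1}"
    and "\<lbrakk>f \<in> sq_integrable M (sigma_join2 M F H); g \<in> sq_integrable M (sigma_join2 M G H);
      AE x in M. real_cond_exp M H f x = 0; AE x in M. real_cond_exp M H g x = 0\<rbrakk>
      \<Longrightarrow> \<bar>expectation (\<lambda>x. f x * g x)\<bar> \<le> subj_corr M H F G * sd M f * sd M g"
proof -
  define R where "R f g \<longleftrightarrow> f \<in> sq_integrable M (sigma_join2 M F H) \<and>
    g \<in> sq_integrable M (sigma_join2 M G H) \<and>
    (AE x in M. real_cond_exp M H f x = 0) \<and> (AE x in M. real_cond_exp M H g x = 0)" for f g
  define S where "S = {e \<in> {0..1}. \<forall>f g. R f g \<longrightarrow>
    \<bar>expectation (\<lambda>x. f x * g x)\<bar> \<le> e * sd M f * sd M g}"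
  have subj: "subj_corr M H F G = (LEAST e. e \<in> S)"
    unfolding subj_corr_def S_def R_def by (rule arg_cong[of _ _ Least]) (auto simp: fun_eq_iff)
  interpret H: sigma_finite_subalgebra M H using H by (simp add: sigma_finite_subalgebraI)
  have "1 \<in> S"
  proof -
    have "\<bar>expectation (\<lambda>x. f x * g x)\<bar> \<le> sd M f * sd M g" if "R f g" for f g
    proof -
      have fg: "f \<in> sq_integrable M M" "g \<in> sq_integrable M M"
        using that sq_integrable_mono[OF subalgebra_sigma_join2[OF F H]]
          sq_integrable_mono[OF subalgebra_sigma_join2[OF G H]] by (auto simp: R_def)
      \<comment> \<open>Vanishing conditional expectation makes \<open>f\<close> and
        \<open>g\<close> centred, so that \<open>sd\<close> is the L2 norm and Cauchy-Schwarz
        applies with constant 1.\<close>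
      have "expectation f = expectation (real_cond_exp M H f)"
        using sq_integrable_integrable[OF fg(1)] by (simp add: H.real_cond_exp_int)
      also have "\<dots> = 0"
        using that by (intro integral_eq_zero_AE) (auto simp: R_def)
      finally have f0: "expectation f = 0" .
      have "expectation g = expectation (real_cond_exp M H g)"
        using sq_integrable_integrable[OF fg(2)] by (simp add: H.real_cond_exp_int)
      also have "\<dots> = 0"
        using that by (intro integral_eq_zero_AE) (auto simp: R_def)
      finally have g0: "expectation g = 0" .
      show ?thesis
        using Cauchy_Schwarz_expectation[OF fg] by (simp add: sd_centered f0 g0)
    qed
    then show ?thesis by (simp add: S_def)
  qed
  have "closed S"
  proof -
    \<comment> \<open>Each pair \<open>f\<close>, \<open>g\<close> imposes a non-strict inequality
      that is affine in \<open>e\<close>, hence a closed condition.\<close>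
    have "S = {0..1} \<inter> (\<Inter>(f, g)\<in>{(f, g). R f g}.
        {e. \<bar>expectation (\<lambda>x. f x * g x)\<bar> \<le> e * sd M f * sd M g})"
      by (auto simp: S_def)
    also have "closed \<dots>"
      by (intro closed_Int closed_INT closed_atLeastAtMost ballI)
         (auto split: prod.split intro!: closed_Collect_le continuous_intros)
    finally show ?thesis .
  qed
  have bdd: "bdd_below S" by (rule bdd_belowI[of _ 0]) (auto simp: S_def)
  have "Inf S \<in> S"
    using closed_contains_Inf[OF _ bdd \<open>closed S\<close>] \<open>1 \<in> S\<close> by blast
  moreover have "subj_corr M H F G = Inf S"
    unfolding subj by (rule Least_equality) (auto intro: \<open>Inf S \<in> S\<close> cInf_lower bdd)
  ultimately have "subj_corr M H F G \<in> S" by simp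
  then show "subj_corr M H F G \<in> {0..1}"
    and "\<lbrakk>f \<in> sq_integrable M (sigma_join2 M F H); g \<in> sq_integrable M (sigma_join2 M G H);
      AE x in M. real_cond_exp M H f x = 0; AE x in M. real_cond_exp M H g x = 0\<rbrakk>
      \<Longrightarrow> \<bar>expectation (\<lambda>x. f x * g x)\<bar> \<le> subj_corr M H F G * sd M f * sd M g"
    by (auto simp: S_def R_def)
qed

text \<open>The part of the residual \<open>h\<close> that the additional sigma-algebra
  \<open>F\<close> explains is its projection \<open>f\<close>. The subjective correlation bounds
  the norm of \<open>f\<close> by \<open>e\<close> times that of \<open>h\<close>, and Pythagoras
  leaves at least the fraction \<open>1 - e^2\<close> of the squared norm of
  \<open>h\<close>.\<close>

lemma residual_step:
  assumes F: "subalgebra M F" and G: "subalgebra M G" and H: "subalgebra M H"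
    and e: "subj_corr M H F G \<le> e" and g: "g \<in> sq_integrable M G"
  shows "(1 - e\<^sup>2) * expectation (\<lambda>x. (g x - real_cond_exp M H g x)\<^sup>2)
    \<le> expectation (\<lambda>x. (g x - real_cond_exp M (sigma_join2 M F H) g x)\<^sup>2)"
proof -
  let ?K = "sigma_join2 M F H" and ?GH = "sigma_join2 M G H"
  have K: "subalgebra M ?K" and GH: "subalgebra M ?GH"
    using F G H by (simp_all add: subalgebra_sigma_join2)
  have KH: "subalgebra ?K H" and GH_H: "subalgebra ?GH H" and GH_G: "subalgebra ?GH G"
    using F G H by (simp_all add: subalgebra_sigma_join2_left subalgebra_sigma_join2_right)
  interpret H: sigma_finite_subalgebra M H using H by (rule sigma_finite_subalgebraI)
  interpret K: sigma_finite_subalgebra M ?K using K by (rule sigma_finite_subalgebraI)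
  define q where "q = real_cond_exp M H g"
  define h where "h = (\<lambda>x. g x - q x)"
  define f where "f = real_cond_exp M ?K h"
  have gM: "g \<in> sq_integrable M M" using g sq_integrable_mono[OF G] by blast
  have q: "q \<in> sq_integrable M H"
    unfolding q_def by (rule sq_integrable_cond_exp[OF H gM])
  have qM: "q \<in> sq_integrable M M" using q sq_integrable_mono[OF H] by blast
  have qK: "q \<in> borel_measurable ?K"
    using q sq_integrable_mono[OF KH] by (auto simp: sq_integrable_def)
  have h: "h \<in> sq_integrable M ?GH"
    unfolding h_def using g q sq_integrable_mono[OF GH_H] sq_integrable_mono[OF GH_G]
    by (intro sq_integrable_diff[OF GH]) auto
  have hM: "h \<in> sq_integrable M M" using h sq_integrable_mono[OF GH] by blast
  have f: "f \<in> sq_integrable M ?K"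
    unfolding f_def by (rule sq_integrable_cond_exp[OF K hM])
  have fM: "f \<in> sq_integrable M M" using f sq_integrable_mono[OF K] by blast
  note int = sq_integrable_integrable[OF gM] sq_integrable_integrable[OF qM]
    sq_integrable_integrable[OF hM] sq_integrable_integrable[OF fM]
  have h0: "AE x in M. real_cond_exp M H h x = 0"
  proof -
    have "AE x in M. real_cond_exp M H h x = real_cond_exp M H g x - real_cond_exp M H q x"
      unfolding h_def using int by (intro H.real_cond_exp_diff)
    moreover have "AE x in M. real_cond_exp M H q x = q x"
      using int q by (intro H.real_cond_exp_F_meas) (auto simp: sq_integrable_def)
    ultimately show ?thesis by eventually_elim (simp add: q_def)
  qed
  \<comment> \<open>Tower property: conditioning \<open>f = E[h|K]\<close> further on the smaller
    \<open>H\<close> gives \<open>E[h|H] = 0\<close>.\<close>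
  have f0: "AE x in M. real_cond_exp M H f x = 0"
    using H.real_cond_exp_nested_subalg[OF K KH int(3)] h0
    unfolding f_def by eventually_elim simp
  have "expectation h = 0"
    using H.real_cond_exp_int(2)[OF int(3)] integral_eq_zero_AE[OF h0] by simp
  moreover have "expectation f = 0"
    using H.real_cond_exp_int(2)[OF int(4)] integral_eq_zero_AE[OF f0] by simp
  ultimately have sd: "sd M h = sqrt (expectation (\<lambda>x. (h x)\<^sup>2))"
    "sd M f = sqrt (expectation (\<lambda>x. (f x)\<^sup>2))"
    by (simp_all add: sd_centered)
  \<comment> \<open>As \<open>f\<close> is the projection of \<open>h\<close>, their inner product
    is the squared norm of \<open>f\<close>; the correlation bound thus becomes a quadratic
    inequality for \<open>sd M f\<close>.\<close>
  have fh: "expectation (\<lambda>x. f x * h x) = expectation (\<lambda>x. (f x)\<^sup>2)"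
    using expectation_cond_exp_mult[OF K hM f] by (simp add: f_def power2_eq_square)
  have sd_sq: "(sd M f)\<^sup>2 = expectation (\<lambda>x. (f x)\<^sup>2)" "(sd M h)\<^sup>2 = expectation (\<lambda>x. (h x)\<^sup>2)"
    by (simp_all add: sd)
  have nonneg: "0 \<le> sd M f" "0 \<le> sd M h" by (simp_all add: sd)
  have e0: "0 \<le> e" using subj_corr_attained(1)[OF F G H] e by simp
  have "(sd M f)\<^sup>2 \<le> subj_corr M H F G * sd M f * sd M h"
    using subj_corr_attained(2)[OF F G H f h f0 h0] by (simp add: fh sd_sq)
  also have "\<dots> \<le> e * sd M f * sd M h"
    using e nonneg by (intro mult_right_mono)
  finally have "sd M f * sd M f \<le> (e * sd M h) * sd M f"
    by (simp add: power2_eq_square mult_ac)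
  then have "sd M f \<le> e * sd M h"
    using nonneg e0 by (cases "sd M f = 0") (simp_all add: mult_le_cancel_right)
  then have "(sd M f)\<^sup>2 \<le> e\<^sup>2 * (sd M h)\<^sup>2"
    using nonneg by (metis power_mono power_mult_distrib)
  moreover have "expectation (\<lambda>x. (h x - f x)\<^sup>2) = (sd M h)\<^sup>2 - (sd M f)\<^sup>2"
    using residual_pythagoras[OF K hM] unfolding f_def[symmetric] by (simp add: sd_sq)
  \<comment> \<open>The subtracted \<open>q\<close> is already measurable for the join, so
    \<open>g\<close> and \<open>h = g - q\<close> have the same residual there.\<close>
  moreover have "expectation (\<lambda>x. (g x - real_cond_exp M ?K g x)\<^sup>2)
      = expectation (\<lambda>x. (h x - f x)\<^sup>2)"
  proof (rule integral_cong_AE)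
    have "AE x in M. real_cond_exp M ?K h x = real_cond_exp M ?K g x - real_cond_exp M ?K q x"
      unfolding h_def using int by (intro K.real_cond_exp_diff)
    moreover have "AE x in M. real_cond_exp M ?K q x = q x"
      using int qK by (intro K.real_cond_exp_F_meas)
    ultimately show "AE x in M. (g x - real_cond_exp M ?K g x)\<^sup>2 = (h x - f x)\<^sup>2"
      by eventually_elim (simp add: f_def h_def)
  qed (use gM hM fM in \<open>auto simp: sq_integrable_def\<close>)
  ultimately show ?thesis
    using sd_sq by (simp add: h_def q_def algebra_simps)
qed

text \<open>The join of no sigma-algebras is trivial. This starts the induction over index
  sets.\<close>

lemma cond_exp_sigma_join_empty:
  assumes "integrable M g"
  shows "AE x in M. real_cond_exp M (sigma_join M {} F) g x = expectation g"
proof -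
  have s: "sets (sigma_join M {} F) = {{}, space M}"
    by (simp add: sets_sigma_join sigma_sets_empty_eq)
  interpret T: sigma_finite_subalgebra M "sigma_join M {} F"
    by (intro sigma_finite_subalgebraI subalgebra_sigma_join) simp
  have "set_lebesgue_integral M {} h = 0" for h :: "'a \<Rightarrow> real"
    by (simp add: set_lebesgue_integral_def)
  with assms show ?thesis
    by (intro T.real_cond_exp_charact) (auto simp: s set_integral_space prob_space)
qed

text \<open>The indices are adjoined one by one, and each costs at most one factor
  \<open>1 - (e i)^2\<close>. The step for \<open>i\<close> conditions on the indices adjoined
  before it, which is why the correlation is controlled given the join over every subset
  \<open>J'\<close>.\<close>

lemma residual_prod_le:
  assumes F: "\<forall>i\<in>J. subalgebra M (F i)" and G: "subalgebra M G" and "finite J"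
    and e: "\<And>i. i \<in> J \<Longrightarrow> e i \<in> {0..1}"
    and subj: "\<And>i J'. i \<in> J \<Longrightarrow> J' \<subseteq> J \<Longrightarrow> subj_corr M (sigma_join M J' F) (F i) G \<le> e i"
    and g: "g \<in> sq_integrable M G" and g0: "expectation g = 0"
  shows "(\<Prod>i\<in>J. 1 - (e i)\<^sup>2) * expectation (\<lambda>x. (g x)\<^sup>2)
    \<le> expectation (\<lambda>x. (g x - real_cond_exp M (sigma_join M J F) g x)\<^sup>2)"
  using \<open>finite J\<close> F e subj
proof (induction J)
  case empty
  have gM: "g \<in> sq_integrable M M" using g sq_integrable_mono[OF G] by blast
  then have [measurable]: "g \<in> borel_measurable M" by (simp add: sq_integrable_def)
  have "AE x in M. real_cond_exp M (sigma_join M {} F) g x = 0"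
    using cond_exp_sigma_join_empty[OF sq_integrable_integrable[OF gM], of F] g0 by simp
  then have "expectation (\<lambda>x. (g x - real_cond_exp M (sigma_join M {} F) g x)\<^sup>2)
      = expectation (\<lambda>x. (g x)\<^sup>2)"
    by (intro integral_cong_AE) auto
  then show ?case by simp
next
  case (insert i J)
  have F: "subalgebra M (F i)" "\<forall>i\<in>J. subalgebra M (F i)" using insert.prems(1) by auto
  have "(\<Prod>i\<in>insert i J. 1 - (e i)\<^sup>2) * expectation (\<lambda>x. (g x)\<^sup>2)
      = (1 - (e i)\<^sup>2) * ((\<Prod>i\<in>J. 1 - (e i)\<^sup>2) * expectation (\<lambda>x. (g x)\<^sup>2))"
    using insert.hyps by (simp add: mult.assoc)
  also have "\<dots> \<le> (1 - (e i)\<^sup>2) * expectation (\<lambda>x. (g x - real_cond_exp M (sigma_join M J F) g x)\<^sup>2)"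
  proof (rule mult_left_mono)
    show "(\<Prod>i\<in>J. 1 - (e i)\<^sup>2) * expectation (\<lambda>x. (g x)\<^sup>2)
        \<le> expectation (\<lambda>x. (g x - real_cond_exp M (sigma_join M J F) g x)\<^sup>2)"
      using F insert.prems by (intro insert.IH) auto
    show "0 \<le> 1 - (e i)\<^sup>2" using insert.prems(2)[of i] by (simp add: power_le_one)
  qed
  also have "\<dots> \<le> expectation (\<lambda>x. (g x - real_cond_exp M (sigma_join M (insert i J) F) g x)\<^sup>2)"
    unfolding sigma_join_insert[OF F]
    using insert.prems(3)[of i J] by (intro residual_step[OF _ G _ _ g] F subalgebra_sigma_join) auto
  finally show ?case .
qed

subsection \<open>Density of functions of finitely many variables\<close>

text \<open>Membership in the L2 closure of the functions depending on finitely many of the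
  sigma-algebras \<open>F k\<close>, with squared distances to avoid roots.\<close>

definition cylinder_approx :: "'k set \<Rightarrow> ('k \<Rightarrow> 'a measure) \<Rightarrow> ('a \<Rightarrow> real) \<Rightarrow> bool"
  where "cylinder_approx K F f \<longleftrightarrow> f \<in> sq_integrable M M \<and>
    (\<forall>\<delta>>0. \<exists>J u. finite J \<and> J \<subseteq> K \<and> u \<in> sq_integrable M (sigma_join M J F) \<and>
      expectation (\<lambda>x. (f x - u x)\<^sup>2) < \<delta>)"

lemma cylinder_approx_base:
  assumes F: "\<forall>k\<in>K. subalgebra M (F k)"
    and J: "finite J" "J \<subseteq> K" and f: "f \<in> sq_integrable M (sigma_join M J F)"
  shows "cylinder_approx K F f"
proof -
  have "\<forall>k\<in>J. subalgebra M (F k)" using F J by blast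
  from sq_integrable_mono[OF subalgebra_sigma_join[OF this]] f
  have "f \<in> sq_integrable M M" by blast
  with J f show ?thesis
    unfolding cylinder_approx_def by (auto intro!: exI[of _ J] exI[of _ f])
qed

text \<open>A triangle inequality for squared distances: pointwise the right side exceeds the left
  by \<open>((a - b) - (b - c))^2\<close>.\<close>

lemma expectation_square_diff_triangle:
  assumes "a \<in> sq_integrable M M" "b \<in> sq_integrable M M" "c \<in> sq_integrable M M"
  shows "expectation (\<lambda>x. (a x - c x)\<^sup>2)
    \<le> 2 * expectation (\<lambda>x. (a x - b x)\<^sup>2) + 2 * expectation (\<lambda>x. (b x - c x)\<^sup>2)"
proof -
  note d = sq_integrable_diff[OF subalgebra_refl]
  have "expectation (\<lambda>x. (a x - c x)\<^sup>2)
      \<le> expectation (\<lambda>x. 2 * (a x - b x)\<^sup>2 + 2 * (b x - c x)\<^sup>2)"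
  proof (rule integral_mono)
    fix x
    have "0 \<le> ((a x - b x) - (b x - c x))\<^sup>2" by simp
    then show "(a x - c x)\<^sup>2 \<le> 2 * (a x - b x)\<^sup>2 + 2 * (b x - c x)\<^sup>2"
      by (simp add: power2_eq_square algebra_simps)
  qed (use d[OF assms(1,2)] d[OF assms(2,3)] d[OF assms(1,3)] in \<open>auto simp: sq_integrable_def\<close>)
  then show ?thesis
    using d[OF assms(1,2)] d[OF assms(2,3)] by (simp add: sq_integrable_def)
qed

text \<open>A closure is closed. Two errors below a quarter of the tolerance suffice, since the
  squared triangle inequality doubles each.\<close>

lemma cylinder_approx_closed:
  assumes F: "\<forall>k\<in>K. subalgebra M (F k)" and f: "f \<in> sq_integrable M M"
    and close: "\<And>\<delta>. 0 < \<delta> \<Longrightarrow> \<exists>v. cylinder_approx K F v \<and> expectation (\<lambda>x. (f x - v x)\<^sup>2) < \<delta>"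
  shows "cylinder_approx K F f"
  unfolding cylinder_approx_def
proof (intro conjI allI impI f)
  fix \<delta> :: real assume "0 < \<delta>"
  then obtain v where v: "cylinder_approx K F v" "expectation (\<lambda>x. (f x - v x)\<^sup>2) < \<delta> / 4"
    using close[of "\<delta> / 4"] by auto
  moreover from \<open>0 < \<delta>\<close> have "0 < \<delta> / 4" by simp
  ultimately obtain J u where J: "finite J" "J \<subseteq> K" and u: "u \<in> sq_integrable M (sigma_join M J F)"
    and uv: "expectation (\<lambda>x. (v x - u x)\<^sup>2) < \<delta> / 4"
    unfolding cylinder_approx_def by blast
  have "\<forall>k\<in>J. subalgebra M (F k)" using F J by blast
  from sq_integrable_mono[OF subalgebra_sigma_join[OF this]] u
  have uM: "u \<in> sq_integrable M M" by blast
  have "expectation (\<lambda>x. (f x - u x)\<^sup>2) < \<delta>"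
    using expectation_square_diff_triangle[OF f _ uM, of v] v uv by (auto simp: cylinder_approx_def)
  with J u show "\<exists>J u. finite J \<and> J \<subseteq> K \<and> u \<in> sq_integrable M (sigma_join M J F) \<and>
      expectation (\<lambda>x. (f x - u x)\<^sup>2) < \<delta>" by blast
qed

lemma cylinder_approx_scale:
  assumes "cylinder_approx K F f"
  shows "cylinder_approx K F (\<lambda>x. c * f x)"
  unfolding cylinder_approx_def
proof (intro conjI allI impI)
  show "(\<lambda>x. c * f x) \<in> sq_integrable M M"
    using assms sq_integrable_scale by (auto simp: cylinder_approx_def)
  fix \<delta> :: real assume "0 < \<delta>"
  \<comment> \<open>Adding 1 keeps the denominator positive when \<open>c = 0\<close>.\<close>
  then have "0 < \<delta> / (c\<^sup>2 + 1)" by (simp add: add_nonneg_pos)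
  with assms obtain J u where J: "finite J" "J \<subseteq> K" and u: "u \<in> sq_integrable M (sigma_join M J F)"
    and fu: "expectation (\<lambda>x. (f x - u x)\<^sup>2) < \<delta> / (c\<^sup>2 + 1)"
    unfolding cylinder_approx_def by blast
  have "expectation (\<lambda>x. (c * f x - c * u x)\<^sup>2) = c\<^sup>2 * expectation (\<lambda>x. (f x - u x)\<^sup>2)"
    by (simp add: power_mult_distrib flip: right_diff_distrib)
  also have "\<dots> \<le> (c\<^sup>2 + 1) * expectation (\<lambda>x. (f x - u x)\<^sup>2)"
    by (intro mult_right_mono) auto
  also have "\<dots> < \<delta>" using fu by (simp add: pos_less_divide_eq add_nonneg_pos mult.commute)
  finally show "\<exists>J u. finite J \<and> J \<subseteq> K \<and> u \<in> sq_integrable M (sigma_join M J F) \<and>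
      expectation (\<lambda>x. (c * f x - u x)\<^sup>2) < \<delta>"
    using J sq_integrable_scale[OF u, of c] by blast
qed

lemma cylinder_approx_add:
  assumes F: "\<forall>k\<in>K. subalgebra M (F k)"
    and f: "cylinder_approx K F f" and g: "cylinder_approx K F g"
  shows "cylinder_approx K F (\<lambda>x. f x + g x)"
proof (rule cylinder_approx_closed[OF F])
  have fM: "f \<in> sq_integrable M M" and gM: "g \<in> sq_integrable M M"
    using f g by (auto simp: cylinder_approx_def)
  show "(\<lambda>x. f x + g x) \<in> sq_integrable M M"
    by (intro sq_integrable_add subalgebra_refl fM gM)
  fix \<delta> :: real assume "0 < \<delta>"
  then have "0 < \<delta> / 4" by simp
  with f obtain J u where J: "finite J" "J \<subseteq> K"
    and u: "u \<in> sq_integrable M (sigma_join M J F)" "expectation (\<lambda>x. (f x - u x)\<^sup>2) < \<delta> / 4"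
    unfolding cylinder_approx_def by blast
  from \<open>0 < \<delta> / 4\<close> g obtain J' v where J': "finite J'" "J' \<subseteq> K"
    and v: "v \<in> sq_integrable M (sigma_join M J' F)" "expectation (\<lambda>x. (g x - v x)\<^sup>2) < \<delta> / 4"
    unfolding cylinder_approx_def by blast
  have FJ: "\<forall>k\<in>J \<union> J'. subalgebra M (F k)" using F J J' by blast
  note mono = subalgebra_sigma_join_mono[OF FJ, THEN sq_integrable_mono]
  have uv: "u \<in> sq_integrable M (sigma_join M (J \<union> J') F)"
    "v \<in> sq_integrable M (sigma_join M (J \<union> J') F)"
    using mono[of J] mono[of J'] u v by auto
  then have uvM: "u \<in> sq_integrable M M" "v \<in> sq_integrable M M"
    using sq_integrable_mono[OF subalgebra_sigma_join[OF FJ]] by auto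
  have "cylinder_approx K F (\<lambda>x. u x + v x)"
    using J J' uv FJ by (intro cylinder_approx_base[OF F, of "J \<union> J'"] sq_integrable_add subalgebra_sigma_join) auto
  \<comment> \<open>Passing through \<open>u + g\<close> replaces one summand at a time.\<close>
  moreover have "expectation (\<lambda>x. ((f x + g x) - (u x + v x))\<^sup>2) < \<delta>"
    using expectation_square_diff_triangle[of "\<lambda>x. f x + g x" "\<lambda>x. u x + g x" "\<lambda>x. u x + v x"]
      u(2) v(2) sq_integrable_add[OF subalgebra_refl fM gM] sq_integrable_add[OF subalgebra_refl uvM]
      sq_integrable_add[OF subalgebra_refl uvM(1) gM] by simp
  ultimately show "\<exists>v. cylinder_approx K F v \<and> expectation (\<lambda>x. ((f x + g x) - v x)\<^sup>2) < \<delta>"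
    by blast
qed

text \<open>Since \<open>0 \<le> U n \<le> f\<close>, the squared errors are dominated by
  \<open>f^2\<close>, and dominated convergence gives L2 convergence.\<close>

lemma cylinder_approx_LIMSEQ:
  assumes F: "\<forall>k\<in>K. subalgebra M (F k)" and U: "\<And>n. cylinder_approx K F (U n)"
    and f: "f \<in> sq_integrable M M"
    and lim: "\<And>x. x \<in> space M \<Longrightarrow> (\<lambda>n. U n x) \<longlonglongrightarrow> f x"
    and bound: "\<And>n x. x \<in> space M \<Longrightarrow> 0 \<le> U n x \<and> U n x \<le> f x"
  shows "cylinder_approx K F f"
proof (rule cylinder_approx_closed[OF F f])
  have [measurable]: "f \<in> borel_measurable M" "U n \<in> borel_measurable M" for n
    using f U[of n] by (auto simp: sq_integrable_def cylinder_approx_def)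
  have "(\<lambda>n. expectation (\<lambda>x. (f x - U n x)\<^sup>2)) \<longlonglongrightarrow> expectation (\<lambda>x. 0)"
  proof (rule integral_dominated_convergence[where w = "\<lambda>x. (f x)\<^sup>2"])
    show "integrable M (\<lambda>x. (f x)\<^sup>2)" using f by (simp add: sq_integrable_def)
    show "AE x in M. (\<lambda>n. (f x - U n x)\<^sup>2) \<longlonglongrightarrow> 0"
    proof (rule AE_I2)
      fix x assume "x \<in> space M"
      from tendsto_power[OF tendsto_diff[OF tendsto_const lim[OF this]], of "f x" 2]
      show "(\<lambda>n. (f x - U n x)\<^sup>2) \<longlonglongrightarrow> 0" by simp
    qed
    show "AE x in M. norm ((f x - U n x)\<^sup>2) \<le> (f x)\<^sup>2" for n
      using bound[of _ n] by (intro AE_I2) (auto intro!: power_mono)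
  qed auto
  then have *: "(\<lambda>n. expectation (\<lambda>x. (f x - U n x)\<^sup>2)) \<longlonglongrightarrow> 0" by simp
  fix \<delta> :: real assume "0 < \<delta>"
  from order_tendstoD(2)[OF * this] obtain n where "expectation (\<lambda>x. (f x - U n x)\<^sup>2) < \<delta>"
    by (auto simp: eventually_sequentially)
  with U show "\<exists>v. cylinder_approx K F v \<and> expectation (\<lambda>x. (f x - v x)\<^sup>2) < \<delta>" by blast
qed

lemma indicator_sq_integrable:
  "A \<in> sets F \<Longrightarrow> A \<in> sets M \<Longrightarrow> indicator A \<in> sq_integrable M F"
  unfolding sq_integrable_def
  by (auto intro!: integrable_const_bound[where B = 1] AE_I2 simp: indicator_def)

text \<open>Dynkin's pi-lambda argument: the events depending on finitely many indices form a
  pi-system that generates the full join, and the events with approximable indicator are closed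
  under complements and countable disjoint unions.\<close>

lemma cylinder_approx_indicator:
  assumes F: "\<forall>k\<in>K. subalgebra M (F k)" and A: "A \<in> sets (sigma_join M K F)"
  shows "cylinder_approx K F (indicator A)"
proof -
  let ?C = "\<Union>J\<in>{J. finite J \<and> J \<subseteq> K}. sets (sigma_join M J F)"
  have FJ: "\<forall>k\<in>J. subalgebra M (F k)" if "J \<subseteq> K" for J using F that by blast
  have sub: "sets (sigma_join M J F) \<subseteq> sets (sigma_join M K F)" if "J \<subseteq> K" for J
    using subalgebra_sigma_join_mono[OF F that] by (simp add: subalgebra_def)
  have KM: "sets (sigma_join M K F) \<subseteq> sets M"
    using subalgebra_sigma_join[OF F] by (simp add: subalgebra_def)
  have CM: "?C \<subseteq> sets M" using sub KM by blast
  have "sets (sigma_join M K F) \<subseteq> sigma_sets (space M) ?C"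
    unfolding sets_sigma_join[OF F]
  proof (rule sigma_sets_mono, safe)
    fix k B assume "k \<in> K" "B \<in> sets (F k)"
    then have "B \<in> sets (sigma_join M {k} F)"
      using F by (subst sets_sigma_join) auto
    with \<open>k \<in> K\<close> show "B \<in> sigma_sets (space M) ?C"
      by (intro sigma_sets.Basic) (auto intro!: exI[of _ "{k}"])
  qed
  with A have AC: "A \<in> sigma_sets (space M) ?C" by blast
  \<comment> \<open>Events over \<open>J\<close> and over \<open>J'\<close> are both events over the
    finite set \<open>J \<union> J'\<close>.\<close>
  have stable: "Int_stable ?C"
  proof (rule Int_stableI)
    fix a b assume "a \<in> ?C" "b \<in> ?C"
    then obtain J J' where J: "finite J" "J \<subseteq> K" "a \<in> sets (sigma_join M J F)"
      "finite J'" "J' \<subseteq> K" "b \<in> sets (sigma_join M J' F)" by auto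
    have "J \<union> J' \<subseteq> K" using J by blast
    note m = subalgebra_sigma_join_mono[OF FJ[OF this], unfolded subalgebra_def]
    have "a \<inter> b \<in> sets (sigma_join M (J \<union> J') F)"
      using m[of J] m[of J'] J by (intro sets.Int) auto
    with J show "a \<inter> b \<in> ?C" by (intro UN_I[of "J \<union> J'"]) auto
  qed
  have Pow: "?C \<subseteq> Pow (space M)" using CM sets.sets_into_space by blast
  from stable Pow AC show ?thesis
  proof (induction rule: sigma_sets_induct_disjoint)
    case (basic B)
    then obtain J where J: "finite J" "J \<subseteq> K" "B \<in> sets (sigma_join M J F)" by blast
    with CM basic show ?case
      by (intro cylinder_approx_base[OF F J(1,2)] indicator_sq_integrable) auto
  next
    case empty
    show ?case
      using cylinder_approx_base[OF F _ _ sq_integrable_const, of "{}" 0] by simp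
  next
    case (compl B)
    \<comment> \<open>\<open>indicator (space M)\<close> stands in for the constant 1, so that
      subtracting \<open>indicator B\<close> gives the indicator of the complement also at points
      outside \<open>space M\<close>.\<close>
    have "indicator (space M) \<in> sq_integrable M (sigma_join M {} F)"
      using sets.top[of "sigma_join M {} F"] by (intro indicator_sq_integrable) auto
    then have "cylinder_approx K F (indicator (space M))"
      by (intro cylinder_approx_base[OF F]) auto
    from cylinder_approx_add[OF F this cylinder_approx_scale[OF compl.IH, of "-1"]]
    have "cylinder_approx K F (\<lambda>x. indicator (space M) x - indicator B x)" by simp
    moreover have "B \<subseteq> space M" using sigma_sets_into_sp[OF Pow compl.hyps] .
    then have "(\<lambda>x. indicator (space M) x - indicator B x) = (indicator (space M - B) :: _ \<Rightarrow> real)"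
      by (auto simp: fun_eq_iff indicator_def)
    ultimately show ?case by simp
  next
    case (union B)
    have "range B \<subseteq> sets M"
      using union(2) sets.sigma_sets_subset[OF CM] by blast
    then have BM: "(\<Union>i. B i) \<in> sets M" by blast
    have ind: "indicator (\<Union>i<n. B i) x = (\<Sum>i<n. indicator (B i) x :: real)" for n x
      using union(1) by (intro indicator_UN_disjoint) (auto simp: disjoint_family_on_def)
    show ?case
    proof (rule cylinder_approx_LIMSEQ[OF F, where U = "\<lambda>n x. \<Sum>i<n. indicator (B i) x"])
      show "cylinder_approx K F (\<lambda>x. \<Sum>i<n. indicator (B i) x)" for n
      proof (induction n)
        case 0
        show ?case
          using cylinder_approx_base[OF F _ _ sq_integrable_const, of "{}" 0] by simp
      next
        case (Suc n)
        from cylinder_approx_add[OF F this union(3)[of n]] show ?case by simp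
      qed
      show "indicator (\<Union>i. B i) \<in> sq_integrable M M"
        using BM by (intro indicator_sq_integrable)
      show "(\<lambda>n. \<Sum>i<n. indicator (B i) x) \<longlonglongrightarrow> (indicator (\<Union>i. B i) x :: real)" for x
        unfolding ind[symmetric] by (rule LIMSEQ_indicator_UN)
      show "0 \<le> (\<Sum>i<n. indicator (B i) x :: real) \<and> (\<Sum>i<n. indicator (B i) x) \<le> (indicator (\<Union>i. B i) x :: real)" for n x
      proof
        show "0 \<le> (\<Sum>i<n. indicator (B i) x :: real)" by (simp add: sum_nonneg)
        show "(\<Sum>i<n. indicator (B i) x) \<le> (indicator (\<Union>i. B i) x :: real)"
          unfolding ind[symmetric] by (intro indicator_leI) auto
      qed
    qed
  qed
qed

text \<open>Induction from indicators through scaling, sums and monotone limits.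
  Square-integrability is a premise inside the induction claim because the induction rule itself
  provides only measurability of the building blocks.\<close>

lemma cylinder_approx_nonneg:
  assumes F: "\<forall>k\<in>K. subalgebra M (F k)" and f: "f \<in> sq_integrable M (sigma_join M K F)"
    and nonneg: "\<And>x. 0 \<le> f x"
  shows "cylinder_approx K F f"
proof -
  let ?K = "sigma_join M K F"
  note meas = measurable_from_subalg[OF subalgebra_sigma_join[OF F]]
  have "f \<in> borel_measurable ?K" using f by (simp add: sq_integrable_def)
  then have "integrable M (\<lambda>x. (f x)\<^sup>2) \<longrightarrow> cylinder_approx K F f"
    using nonneg
  proof (induction rule: borel_measurable_induct_real)
    case (set A)
    then show ?case using cylinder_approx_indicator[OF F] by simp
  next
    case (mult u c)
    show ?case
    \<comment> \<open>Integrability of \<open>(c * u)^2\<close> yields that of \<open>u^2\<close>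
      only for nonzero \<open>c\<close>.\<close>
    proof (cases "c = 0")
      case True
      then show ?thesis
        using cylinder_approx_base[OF F _ _ sq_integrable_const, of "{}" 0] by simp
    next
      case False
      with mult show ?thesis by (simp add: power_mult_distrib cylinder_approx_scale)
    qed
  next
    case (add u v)
    have [measurable]: "u \<in> borel_measurable M" "v \<in> borel_measurable M"
      using add.hyps meas by auto
    show ?case
    proof
      assume i: "integrable M (\<lambda>x. (v x + u x)\<^sup>2)"
      \<comment> \<open>Both summands are nonnegative, so each is dominated by the sum.\<close>
      have "integrable M (\<lambda>x. (u x)\<^sup>2)" "integrable M (\<lambda>x. (v x)\<^sup>2)"
        using add.hyps by (auto intro!: Bochner_Integration.integrable_bound[OF i] power_mono)
      with add.IH show "cylinder_approx K F (\<lambda>x. v x + u x)"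
        using cylinder_approx_add[OF F, of v u] by simp
    qed
  next
    case (seq U)
    have [measurable]: "U n \<in> borel_measurable M" for n
      using seq.hyps(1) meas by auto
    have le: "U n x \<le> f x" if "x \<in> space M" for n x
    proof (rule incseq_le)
      show "incseq (\<lambda>n. U n x)" using \<open>incseq U\<close> by (simp add: incseq_def le_fun_def)
      show "(\<lambda>n. U n x) \<longlonglongrightarrow> f x" using seq.hyps that by simp
    qed
    show ?case
    proof
      assume i: "integrable M (\<lambda>x. (f x)\<^sup>2)"
      have "integrable M (\<lambda>x. (U n x)\<^sup>2)" for n
        using seq.hyps(2) le
        by (intro Bochner_Integration.integrable_bound[OF i] AE_I2) (auto intro!: power_mono)
      then have U: "cylinder_approx K F (U n)" for n using seq.IH by blast
      show "cylinder_approx K F f"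
      proof (rule cylinder_approx_LIMSEQ[OF F U])
        show "f \<in> sq_integrable M M"
          using f i meas by (simp add: sq_integrable_def)
      qed (use seq.hyps le in auto)
    qed
  qed
  with f show ?thesis by (simp add: sq_integrable_def)
qed

lemma sq_integrable_sigma_join_approx:
  assumes F: "\<forall>k\<in>K. subalgebra M (F k)" and f: "f \<in> sq_integrable M (sigma_join M K F)"
  shows "cylinder_approx K F f"
proof -
  let ?K = "sigma_join M K F"
  have [measurable]: "f \<in> borel_measurable ?K" "f \<in> borel_measurable M"
    using f sq_integrable_mono[OF subalgebra_sigma_join[OF F]] by (auto simp: sq_integrable_def)
  have i: "integrable M (\<lambda>x. (f x)\<^sup>2)" using f by (simp add: sq_integrable_def)
  \<comment> \<open>Positive and negative part; the square of each is at most
    \<open>f^2\<close>.\<close>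
  have "cylinder_approx K F (\<lambda>x. max 0 (f x))" "cylinder_approx K F (\<lambda>x. max 0 (- f x))"
    by (intro cylinder_approx_nonneg[OF F];
        auto simp: sq_integrable_def max_def intro!: Bochner_Integration.integrable_bound[OF i])+
  from cylinder_approx_add[OF F this(1) cylinder_approx_scale[OF this(2), of "-1"]]
  have "cylinder_approx K F (\<lambda>x. max 0 (f x) + -1 * max 0 (- f x))" .
  moreover have "(\<lambda>x. max 0 (f x) + -1 * max 0 (- f x)) = f" by (auto simp: max_def)
  ultimately show ?thesis by simp
qed

subsection \<open>The bound on the maximal correlation\<close>

text \<open>Against an \<open>H\<close>-measurable \<open>f\<close>, \<open>g\<close> may be
  replaced by its projection, whose squared norm is at most \<open>1 - p\<close> times that of
  \<open>g\<close> by Pythagoras. Cauchy-Schwarz then finishes.\<close>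

lemma abs_expectation_mult_le:
  assumes H: "subalgebra M H" and g: "g \<in> sq_integrable M M"
    and p: "p * expectation (\<lambda>x. (g x)\<^sup>2) \<le> expectation (\<lambda>x. (g x - real_cond_exp M H g x)\<^sup>2)"
    and f: "f \<in> sq_integrable M H"
  shows "\<bar>expectation (\<lambda>x. f x * g x)\<bar>
    \<le> sqrt (1 - p) * (sqrt (expectation (\<lambda>x. (f x)\<^sup>2)) * sqrt (expectation (\<lambda>x. (g x)\<^sup>2)))"
proof -
  have fM: "f \<in> sq_integrable M M" using f sq_integrable_mono[OF H] by blast
  have cM: "real_cond_exp M H g \<in> sq_integrable M M"
    using sq_integrable_cond_exp[OF H g] sq_integrable_mono[OF H] by blast
  have "expectation (\<lambda>x. (real_cond_exp M H g x)\<^sup>2) \<le> (1 - p) * expectation (\<lambda>x. (g x)\<^sup>2)"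
    using p residual_pythagoras[OF H g] by (simp add: algebra_simps)
  then have "sqrt (expectation (\<lambda>x. (real_cond_exp M H g x)\<^sup>2))
      \<le> sqrt (1 - p) * sqrt (expectation (\<lambda>x. (g x)\<^sup>2))"
    by (simp flip: real_sqrt_mult)
  then have "sqrt (expectation (\<lambda>x. (f x)\<^sup>2)) * sqrt (expectation (\<lambda>x. (real_cond_exp M H g x)\<^sup>2))
      \<le> sqrt (expectation (\<lambda>x. (f x)\<^sup>2)) * (sqrt (1 - p) * sqrt (expectation (\<lambda>x. (g x)\<^sup>2)))"
    by (intro mult_left_mono) simp_all
  then show ?thesis
    using Cauchy_Schwarz_expectation[OF fM cM] expectation_cond_exp_mult[OF H g f]
    by (simp add: mult_ac)
qed

text \<open>One constant \<open>p\<close> serves all finite \<open>J\<close>, so the bound for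
  finite joins passes to the full join by density.\<close>

lemma abs_expectation_mult_sigma_join_le:
  assumes F: "\<forall>k\<in>K. subalgebra M (F k)" and g: "g \<in> sq_integrable M M" and "p \<le> 1"
    and p: "\<And>J. finite J \<Longrightarrow> J \<subseteq> K \<Longrightarrow> p * expectation (\<lambda>x. (g x)\<^sup>2)
      \<le> expectation (\<lambda>x. (g x - real_cond_exp M (sigma_join M J F) g x)\<^sup>2)"
    and f: "f \<in> sq_integrable M (sigma_join M K F)"
  shows "\<bar>expectation (\<lambda>x. f x * g x)\<bar>
    \<le> sqrt (1 - p) * (sqrt (expectation (\<lambda>x. (f x)\<^sup>2)) * sqrt (expectation (\<lambda>x. (g x)\<^sup>2)))"
proof (rule field_le_epsilon)
  fix \<eta> :: real assume "0 < \<eta>"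
  define ng where "ng = sqrt (expectation (\<lambda>x. (g x)\<^sup>2))"
  define nf where "nf = sqrt (expectation (\<lambda>x. (f x)\<^sup>2))"
  have ng: "0 \<le> ng" by (simp add: ng_def)
  \<comment> \<open>Chosen so that \<open>d * ng\<close> is at most the allowed error; the added 1
    covers \<open>ng = 0\<close>.\<close>
  define d where "d = \<eta> / (ng + 1)"
  have "0 < d" using \<open>0 < \<eta>\<close> ng by (simp add: d_def)
  then have "0 < d\<^sup>2" by simp
  have approx: "cylinder_approx K F f" by (rule sq_integrable_sigma_join_approx[OF F f])
  then have fM: "f \<in> sq_integrable M M" by (simp add: cylinder_approx_def)
  obtain J u where J: "finite J" "J \<subseteq> K" and u: "u \<in> sq_integrable M (sigma_join M J F)"
    and fu: "expectation (\<lambda>x. (f x - u x)\<^sup>2) < d\<^sup>2"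
    using approx \<open>0 < d\<^sup>2\<close> unfolding cylinder_approx_def by blast
  have "\<forall>k\<in>J. subalgebra M (F k)" using F J by blast
  then have H: "subalgebra M (sigma_join M J F)" by (rule subalgebra_sigma_join)
  \<comment> \<open>Passing from \<open>u\<close> to the projection \<open>c\<close> of \<open>f\<close> keeps the approximation and gives \<open>E c\<^sup>2 \<le> E f\<^sup>2\<close>.\<close>
  define c where "c = real_cond_exp M (sigma_join M J F) f"
  have c: "c \<in> sq_integrable M (sigma_join M J F)"
    unfolding c_def by (rule sq_integrable_cond_exp[OF H fM])
  then have cM: "c \<in> sq_integrable M M" using sq_integrable_mono[OF H] by blast
  have rM: "(\<lambda>x. f x - c x) \<in> sq_integrable M M"
    by (intro sq_integrable_diff subalgebra_refl fM cM)
  have "expectation (\<lambda>x. (f x - c x)\<^sup>2) \<le> d\<^sup>2"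
    using residual_minimal[OF H fM u] fu by (simp add: c_def)
  then have r: "sqrt (expectation (\<lambda>x. (f x - c x)\<^sup>2)) \<le> d"
    using \<open>0 < d\<close> real_le_lsqrt by simp
  have "0 \<le> expectation (\<lambda>x. (f x - c x)\<^sup>2)" by simp
  then have cf: "sqrt (expectation (\<lambda>x. (c x)\<^sup>2)) \<le> nf"
    using residual_pythagoras[OF H fM] unfolding c_def nf_def by (intro real_sqrt_le_mono) linarith
  \<comment> \<open>The \<open>c\<close> part obeys the bound for the finite join; the remainder is
    small by Cauchy-Schwarz.\<close>
  have "expectation (\<lambda>x. f x * g x) = expectation (\<lambda>x. c x * g x + (f x - c x) * g x)"
    by (simp add: algebra_simps)
  also have "\<dots> = expectation (\<lambda>x. c x * g x) + expectation (\<lambda>x. (f x - c x) * g x)"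
    by (intro Bochner_Integration.integral_add sq_integrable_mult_integrable cM rM g)
  finally have "\<bar>expectation (\<lambda>x. f x * g x)\<bar>
      \<le> \<bar>expectation (\<lambda>x. c x * g x)\<bar> + \<bar>expectation (\<lambda>x. (f x - c x) * g x)\<bar>"
    by simp
  also have "\<bar>expectation (\<lambda>x. c x * g x)\<bar> \<le> sqrt (1 - p) * (sqrt (expectation (\<lambda>x. (c x)\<^sup>2)) * ng)"
    unfolding ng_def by (rule abs_expectation_mult_le[OF H g p[OF J] c])
  also have "\<dots> \<le> sqrt (1 - p) * (nf * ng)"
    using cf ng \<open>p \<le> 1\<close> by (intro mult_left_mono mult_right_mono) auto
  also have "\<bar>expectation (\<lambda>x. (f x - c x) * g x)\<bar> \<le> sqrt (expectation (\<lambda>x. (f x - c x)\<^sup>2)) * ng"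
    unfolding ng_def by (rule Cauchy_Schwarz_expectation[OF rM g])
  also have "\<dots> \<le> d * ng" using r ng by (rule mult_right_mono)
  also have "\<dots> \<le> d * (ng + 1)" using \<open>0 < d\<close> by simp
  also have "\<dots> = \<eta>" using ng by (simp add: d_def)
  finally show "\<bar>expectation (\<lambda>x. f x * g x)\<bar> \<le> sqrt (1 - p)
      * (sqrt (expectation (\<lambda>x. (f x)\<^sup>2)) * sqrt (expectation (\<lambda>x. (g x)\<^sup>2))) + \<eta>"
    by (simp add: nf_def ng_def)
qed

text \<open>Covariance and standard deviation are unchanged by centring, so an inner-product bound
  for centred functions suffices.\<close>

lemma max_corr_leI:
  assumes F: "subalgebra M F" and G: "subalgebra M G" and "0 \<le> c"
    and le: "\<And>f g. f \<in> sq_integrable M F \<Longrightarrow> g \<in> sq_integrable M G \<Longrightarrow>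
      expectation f = 0 \<Longrightarrow> expectation g = 0 \<Longrightarrow>
      \<bar>expectation (\<lambda>x. f x * g x)\<bar>
        \<le> c * (sqrt (expectation (\<lambda>x. (f x)\<^sup>2)) * sqrt (expectation (\<lambda>x. (g x)\<^sup>2)))"
  shows "max_corr M F G \<le> c"
  unfolding max_corr_def
proof (rule cSup_least)
  fix y assume "y \<in> insert 0 {\<bar>Cov M f g\<bar> / (sd M f * sd M g) | f g.
      f \<in> sq_integrable M F \<and> \<not> ae_const M f \<and> g \<in> sq_integrable M G \<and> \<not> ae_const M g}"
  then consider "y = 0" | f g where "y = \<bar>Cov M f g\<bar> / (sd M f * sd M g)"
      "f \<in> sq_integrable M F" "g \<in> sq_integrable M G"
    by blast
  then show "y \<le> c"
  proof cases
    case 1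
    with \<open>0 \<le> c\<close> show ?thesis by simp
  next
    case 2
    have centered: "(\<lambda>x. h x - expectation h) \<in> sq_integrable M H"
      "expectation (\<lambda>x. h x - expectation h) = 0"
      if H: "subalgebra M H" and h: "h \<in> sq_integrable M H" for h H
    proof -
      have "integrable M h"
        using h sq_integrable_mono[OF H] sq_integrable_integrable by blast
      then show "expectation (\<lambda>x. h x - expectation h) = 0" by (simp add: prob_space)
      show "(\<lambda>x. h x - expectation h) \<in> sq_integrable M H"
        by (intro sq_integrable_diff H h sq_integrable_const)
    qed
    have "\<bar>Cov M f g\<bar> \<le> c * (sd M f * sd M g)"
      using le[OF centered(1)[OF F 2(2)] centered(1)[OF G 2(3)]
          centered(2)[OF F 2(2)] centered(2)[OF G 2(3)]]
      by (simp add: Cov_def sd_def)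
    moreover have "0 \<le> sd M f * sd M g" by (simp add: sd_def)
    \<comment> \<open>If the denominator vanishes, the quotient is 0 by the convention for
      division.\<close>
    ultimately show ?thesis
      using \<open>0 \<le> c\<close> by (cases "sd M f * sd M g = 0") (auto simp: 2(1) divide_le_eq)
  qed
qed simp

end

section \<open>From random variables to their sigma-algebras\<close>

lemma subalgebra_vimage_algebra:
  assumes "f \<in> measurable M N"
  shows "subalgebra M (vimage_algebra (space M) f N)"
  unfolding subalgebra_def using sets_image_in_sets[OF _ assms] by simp

text \<open>Each coordinate is measurable for the join, hence so is the vector; functions of the
  vector can therefore be tested as functions on the join.\<close>

lemma subalgebra_sigma_join_vimage_PiM:
  assumes X: "\<And>i. i \<in> I \<Longrightarrow> X i \<in> measurable M (N i)"
  shows "subalgebra (sigma_join M I (\<lambda>i. vimage_algebra (space M) (X i) (N i)))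
    (vimage_algebra (space M) (\<lambda>\<omega>. \<lambda>i\<in>I. X i \<omega>) (\<Pi>\<^sub>M i\<in>I. N i))"
proof -
  let ?F = "\<lambda>i. vimage_algebra (space M) (X i) (N i)"
  let ?K = "sigma_join M I ?F"
  have F: "\<forall>i\<in>I. subalgebra M (?F i)" using X by (simp add: subalgebra_vimage_algebra)
  have "X i \<in> measurable ?K (N i)" if "i \<in> I" for i
  proof -
    have "X i \<in> measurable (?F i) (N i)"
      using measurable_space[OF X[OF that]] by (intro measurable_vimage_algebra1) auto
    moreover have "subalgebra ?K (?F i)"
      using that X unfolding subalgebra_def sets_sigma_join[OF F] by auto
    ultimately show ?thesis by (rule measurable_from_subalg[rotated])
  qed
  then have "(\<lambda>\<omega>. \<lambda>i\<in>I. X i \<omega>) \<in> measurable ?K (\<Pi>\<^sub>M i\<in>I. N i)"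
    by (rule measurable_restrict)
  from subalgebra_vimage_algebra[OF this] show ?thesis by simp
qed

theorem theorem3p2p2:
  fixes M :: "'a measure" and I :: "'i set"
    and N :: "'i \<Rightarrow> 'b measure" and X :: "'i \<Rightarrow> 'a \<Rightarrow> 'b"
    and L :: "'c measure" and Y :: "'a \<Rightarrow> 'c"
    and \<epsilon> :: "'i \<Rightarrow> real"
  assumes "prob_space M"
    and "\<And>i. i \<in> I \<Longrightarrow> X i \<in> measurable M (N i)"
    and "Y \<in> measurable M L"
    and "\<And>i. i \<in> I \<Longrightarrow> \<epsilon> i \<in> {0..1}"
    and "\<And>i. i \<in> I \<Longrightarrow>
      subj_corr_meta M (natural_metalgebra M I N X L Y)
        (vimage_algebra (space M) (X i) (N i)) (vimage_algebra (space M) Y L) \<le> \<epsilon> i"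
  shows "max_corr M
      (vimage_algebra (space M) (\<lambda>\<omega>. \<lambda>i\<in>I. X i \<omega>) (\<Pi>\<^sub>M i\<in>I. N i))
      (vimage_algebra (space M) Y L)
    \<le> sqrt (1 - net_prod (\<lambda>i. 1 - (\<epsilon> i)\<^sup>2) I)"
proof -
  interpret prob_space M by fact
  let ?F = "\<lambda>i. vimage_algebra (space M) (X i) (N i)"
  let ?G = "vimage_algebra (space M) Y L"
  let ?XI = "vimage_algebra (space M) (\<lambda>\<omega>. \<lambda>i\<in>I. X i \<omega>) (\<Pi>\<^sub>M i\<in>I. N i)"
  let ?p = "\<lambda>i. 1 - (\<epsilon> i)\<^sup>2"
  have F: "\<forall>i\<in>I. subalgebra M (?F i)" using assms(2) by (simp add: subalgebra_vimage_algebra)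
  have G: "subalgebra M ?G" using assms(3) by (rule subalgebra_vimage_algebra)
  have subj: "subj_corr M (sigma_join M J ?F) (?F i) ?G \<le> \<epsilon> i" if "i \<in> I" "J \<subseteq> I" for i J
  proof -
    let ?Z = "case_option ?G ?F"
    have Z: "\<forall>k\<in>K'. subalgebra M (?Z k)" if "K' \<subseteq> insert None (Some ` I)" for K'
      using that F G by (auto split: option.split)
    \<comment> \<open>A real supremum dominates its members only when they are bounded above; here 1
      is a bound.\<close>
    have "bdd_above ((\<lambda>H. subj_corr M H (?F i) ?G) ` natural_metalgebra M I N X L Y)"
    proof (rule bdd_aboveI2)
      fix H assume "H \<in> natural_metalgebra M I N X L Y"
      then obtain K' where "H = sigma_join M K' ?Z" "K' \<subseteq> insert None (Some ` I)"
        unfolding natural_metalgebra_def sigma_metalgebra_def by blast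
      then have "subalgebra M H" using Z by (simp add: subalgebra_sigma_join)
      then show "subj_corr M H (?F i) ?G \<le> 1"
        using subj_corr_attained(1)[of "?F i" ?G H] F G \<open>i \<in> I\<close> by simp
    qed
    \<comment> \<open>Omitting the index \<open>None\<close> of \<open>Y\<close> exhibits the join
      over \<open>J\<close> as a member of the metalgebra.\<close>
    moreover have "sigma_join M J ?F = sigma_join M (Some ` J) ?Z"
      by (simp add: sigma_join_def)
    then have "sigma_join M J ?F \<in> natural_metalgebra M I N X L Y"
      unfolding natural_metalgebra_def sigma_metalgebra_def using \<open>J \<subseteq> I\<close> by blast
    ultimately have "subj_corr M (sigma_join M J ?F) (?F i) ?G
        \<le> subj_corr_meta M (natural_metalgebra M I N X L Y) (?F i) ?G"
      unfolding subj_corr_meta_def by (intro cSUP_upper)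
    with assms(5)[OF \<open>i \<in> I\<close>] show ?thesis by simp
  qed
  have p01: "?p i \<in> {0..1}" if "i \<in> I" for i
    using assms(4)[OF that] by (simp add: power_le_one)
  \<comment> \<open>The infinite product is the infimum of the finite ones, which supplies a lower
    bound on the residual factor independent of \<open>J\<close>.\<close>
  have net: "net_prod ?p I \<le> prod ?p J" if "finite J" "J \<subseteq> I" for J
  proof -
    have "bdd_below (prod ?p ` {J. finite J \<and> J \<subseteq> I})"
      using p01 by (intro bdd_belowI[of _ 0]) (fastforce intro!: prod_nonneg)
    then show ?thesis
      using that prod_tendsto_net_prod(2)[of I ?p] p01 by (auto intro: cINF_lower)
  qed
  have net1: "net_prod ?p I \<le> 1" using net[of "{}"] by simp
  note sub = subalgebra_sigma_join_vimage_PiM[of I X M N, OF assms(2)]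
  show ?thesis
  proof (rule max_corr_leI[OF _ G])
    show "subalgebra M ?XI"
      by (intro subalgebra_vimage_algebra measurable_restrict assms(2))
    show "0 \<le> sqrt (1 - net_prod ?p I)" using net1 by simp
    fix f g assume f: "f \<in> sq_integrable M ?XI" and g: "g \<in> sq_integrable M ?G"
      and g0: "expectation g = 0"
    have gM: "g \<in> sq_integrable M M" using g sq_integrable_mono[OF G] by blast
    have fK: "f \<in> sq_integrable M (sigma_join M I ?F)" using f sq_integrable_mono[OF sub] by blast
    show "\<bar>expectation (\<lambda>x. f x * g x)\<bar> \<le> sqrt (1 - net_prod ?p I)
      * (sqrt (expectation (\<lambda>x. (f x)\<^sup>2)) * sqrt (expectation (\<lambda>x. (g x)\<^sup>2)))"
    proof (rule abs_expectation_mult_sigma_join_le[OF F gM net1 _ fK])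
      fix J assume J: "finite J" "J \<subseteq> I"
      have "net_prod ?p I * expectation (\<lambda>x. (g x)\<^sup>2) \<le> prod ?p J * expectation (\<lambda>x. (g x)\<^sup>2)"
        using net[OF J] by (intro mult_right_mono) simp_all
      also have "\<dots> \<le> expectation (\<lambda>x. (g x - real_cond_exp M (sigma_join M J ?F) g x)\<^sup>2)"
      proof (rule residual_prod_le[OF _ G \<open>finite J\<close> _ _ g g0])
        show "\<forall>i\<in>J. subalgebra M (?F i)" using F \<open>J \<subseteq> I\<close> by blast
        show "\<epsilon> i \<in> {0..1}" if "i \<in> J" for i using assms(4) \<open>J \<subseteq> I\<close> that by blast
        show "subj_corr M (sigma_join M J' ?F) (?F i) ?G \<le> \<epsilon> i" if "i \<in> J" "J' \<subseteq> J" for i J'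
          using \<open>J \<subseteq> I\<close> that by (intro subj) auto
      qed
      finally show "net_prod ?p I * expectation (\<lambda>x. (g x)\<^sup>2)
          \<le> expectation (\<lambda>x. (g x - real_cond_exp M (sigma_join M J ?F) g x)\<^sup>2)" .
    qed
  qed
qed

end
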